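(* Let $d\ge 1$ and let $S\subset\mathbb{R}^d$ be a finite set in general position with $|S|>d+1$. Then $S$ is in strong general position if and only if the following holds: for every $r$ with $2\le r\le d+1$ and every collection of $r$ pairwise disjoint subsets $F_1,\ldots,F_r$ of $S$ with $|F_\nu|=d+1-\varepsilon_\nu$ and $1\le\varepsilon_\nu\le d$ for $\nu=1,\ldots,r$, (i) if $\sum_{\nu=1}^r\varepsilon_\nu=d$, then $\bigcap_{\nu=1}^r\operatorname{aff}F_\nu$ consists of exactly one point; and (ii) $\bigcap_{\nu=1}^r\operatorname{aff}F_\nu=\emptyset$ whenever either $\sum_{\nu=1}^r\varepsilon_\nu=d+1$, or both $|S|=r(d+1)-\sum_{\nu=1}^r\varepsilon_\nu$ (i.e. $F_1\cup\cdots\cup F_r=S$) and $d+1<\sum_{\nu=1}^r\varepsilon_\nu\le d+\min\{\varepsilon_\nu:1\le\nu\le r\}$.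
   Context: $\operatorname{aff}F$ denotes the affine hull of $F$; the dimension of the empty set is $-1$. A set $S\subset\mathbb{R}^d$ is in general position if every subset of $S$ of size at most $d+1$ is affinely independent (equivalently $\dim\operatorname{aff}F=\min(d,|F|-1)$ for all $F\subseteq S$). A finite set $S\subset\mathbb{R}^d$ is in strong general position (SGP) if (a) $S$ is in general position, and (b) for every $r$ with $1\le r\le |S|$ and every collection $\{F_1,\ldots,F_r\}$ of $r$ pairwise disjoint subsets of $S$, $d-\dim\bigcap_{\nu=1}^r\operatorname{aff}F_\nu=\min\bigl(d+1,\ \sum_{\nu=1}^r(d-\dim\operatorname{aff}F_\nu)\bigr)$. *)

theory Defs
  imports "HOL-Analysis.Analysis"
begin

text \<open>\<open>finite T\<close> is required because \<^const>\<open>card\<close> is \<open>0\<close> on infinite sets.\<close>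

definition general_position :: "'a::euclidean_space set \<Rightarrow> bool" where
  "general_position S \<longleftrightarrow>
     (\<forall>T. T \<subseteq> S \<and> finite T \<and> card T \<le> DIM('a) + 1 \<longrightarrow> \<not> affine_dependent T)"

text \<open>Collections of \<open>r\<close> pairwise disjoint subsets are indexed families; such a family can repeat
  only the empty set, and the dimension formula holds trivially as soon as some member is empty.
  Dimensions are integers, with \<open>aff_dim {} = -1\<close>.\<close>

definition strong_general_position :: "'a::euclidean_space set \<Rightarrow> bool" where
  "strong_general_position S \<longleftrightarrow>
     finite S \<and> general_position S \<and>
     (\<forall>r F. 1 \<le> r \<and> r \<le> card S \<and> (\<forall>\<nu>\<in>{1..r}. F \<nu> \<subseteq> S) \<and> disjoint_family_on F {1..r} \<longrightarrow>
        int DIM('a) - aff_dim (\<Inter>\<nu>\<in>{1..r}. affine hull (F \<nu>)) =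
        min (int DIM('a) + 1) (\<Sum>\<nu>=1..r. int DIM('a) - aff_dim (affine hull (F \<nu>))))"

end

theory Submission
  imports Defs
begin

text \<open>Write \<open>\<epsilon>\<^sub>\<nu>\<close> for the codimension of \<open>aff F\<^sub>\<nu>\<close>. Empty members and members of full dimension are
  harmless, so assume \<open>1 \<le> \<epsilon>\<^sub>\<nu> \<le> d\<close>. If \<open>\<Sum>\<epsilon>\<^sub>\<nu> \<le> d\<close>, shrink a single member until the codimensions
  add up to \<open>d\<close>; the intersection of the shrunken family is a point, which makes the original
  intersection nonempty and bounds its dimension from above, while the lower bound is general.
  If \<open>\<Sum>\<epsilon>\<^sub>\<nu> > d + 1\<close>, an intersection that is nonempty stays so when a member is discarded or enlarged.
  Discarding is possible with the sum kept above \<open>d\<close> unless \<open>\<Sum>\<epsilon>\<^sub>\<nu> \<le> d + min \<epsilon>\<^sub>\<nu>\<close>, and enlarging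
  unless the members exhaust \<open>S\<close>; so the sum descends to one of the two cases of (ii).\<close>

section \<open>Dimension of intersections of affine subspaces, and hulls in general position\<close>

text \<open>The sumset of \<open>A\<close> and \<open>B\<close> has dimension
  \<open>aff_dim A + aff_dim B - aff_dim (A \<inter> B)\<close> and lies in a translate of
  \<open>C\<close>: for a common point \<open>p\<close>, \<open>x + y - p\<close> is an affine
  combination of points of \<open>C\<close>. The bound is relative to \<open>C\<close> because it is
  applied both in the whole space and inside a single hull.\<close>

lemma aff_dim_Int_ge:
  fixes A B C :: "'a::euclidean_space set"
  assumes "affine A" "affine B" "affine C" "A \<subseteq> C" "B \<subseteq> C" "A \<inter> B \<noteq> {}"
  shows "aff_dim A + aff_dim B \<le> aff_dim C + aff_dim (A \<inter> B)"
proof -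
  obtain p where p: "p \<in> A" "p \<in> B" using assms by blast
  have "{x + y |x y. x \<in> A \<and> y \<in> B} \<subseteq> (+) p ` C"
  proof clarify
    fix x y assume "x \<in> A" "y \<in> B"
    then have "1 *\<^sub>R x + 1 *\<^sub>R y + (- 1) *\<^sub>R p \<in> C"
      using assms p by (intro mem_affine_3) auto
    then have "x + y - p \<in> C" by simp
    then show "x + y \<in> (+) p ` C"
      by (rule rev_image_eqI) simp
  qed
  from aff_dim_subset[OF this] show ?thesis
    using aff_dim_sums_Int[OF assms(1,2,6)] by (simp add: aff_dim_translation_eq)
qed

text \<open>Codimension is subadditive, by induction with \<open>UNIV\<close> as ambient space.
  Nonemptiness matters: two distinct parallel lines in the plane have codimensions adding up to 2,
  but the empty set has codimension 3.\<close>

lemma aff_dim_INT_ge: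
  fixes A :: "'i \<Rightarrow> 'a::euclidean_space set"
  assumes "finite I" "\<And>i. i \<in> I \<Longrightarrow> affine (A i)" "(\<Inter>i\<in>I. A i) \<noteq> {}"
  shows "int DIM('a) - aff_dim (\<Inter>i\<in>I. A i) \<le> (\<Sum>i\<in>I. int DIM('a) - aff_dim (A i))"
  using assms
proof (induction I rule: finite_induct)
  case empty
  then show ?case by simp
next
  case (insert i I)
  have "affine (\<Inter>i\<in>I. A i)" using insert.prems by (intro affine_Inter) auto
  then have "aff_dim (A i) + aff_dim (\<Inter>i\<in>I. A i)
      \<le> aff_dim (UNIV :: 'a set) + aff_dim (A i \<inter> (\<Inter>i\<in>I. A i))"
    using insert.prems by (intro aff_dim_Int_ge) auto
  moreover have "int DIM('a) - aff_dim (\<Inter>i\<in>I. A i) \<le> (\<Sum>i\<in>I. int DIM('a) - aff_dim (A i))"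
    using insert.prems by (intro insert.IH) auto
  ultimately show ?case using insert.hyps by simp
qed

lemma general_position_aff_dim:
  fixes S :: "'a::euclidean_space set"
  assumes "general_position S" "F \<subseteq> S" "finite F" "card F \<le> DIM('a) + 1"
  shows "aff_dim F = int (card F) - 1"
proof -
  have "\<not> affine_dependent F" using assms by (simp add: general_position_def)
  then show ?thesis using aff_dim_affine_independent[of F] by simp
qed

lemma general_position_codim:
  fixes S :: "'a::euclidean_space set"
  assumes "general_position S" "F \<subseteq> S" "finite F" "card F \<le> DIM('a) + 1"
  shows "int DIM('a) - aff_dim (affine hull F) = int (DIM('a) + 1 - card F)"
  using general_position_aff_dim[OF assms] assms(4) by (simp add: of_nat_diff)

text \<open>Any d + 1 points of \<open>F\<close> are affinely independent and already span the
  space.\<close>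

lemma general_position_affine_hull_UNIV:
  fixes S :: "'a::euclidean_space set"
  assumes "general_position S" "F \<subseteq> S" "finite F" "DIM('a) + 1 \<le> card F"
  shows "affine hull F = UNIV"
proof -
  obtain T where T: "T \<subseteq> F" "card T = DIM('a) + 1" "finite T"
    using assms(3,4) obtain_subset_with_card_n by metis
  then have "aff_dim T = int DIM('a)"
    using general_position_aff_dim[of S T] assms(1,2) by auto
  then have "aff_dim F = int DIM('a)"
    using aff_dim_subset[OF T(1)] aff_dim_le_DIM[of F] by linarith
  then show ?thesis by (simp add: affine_hull_UNIV aff_dim_eq_full)
qed

section \<open>Families of proper members and their codimension sums\<close>

text \<open>For finite \<open>S\<close>, the bounds on the members say 1 \<le> \<epsilon> \<le> d.
  The index set is arbitrary so that members can be discarded without renumbering.\<close>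

definition proper_family :: "'a::euclidean_space set \<Rightarrow> 'i set \<Rightarrow> ('i \<Rightarrow> 'a set) \<Rightarrow> bool" where
  "proper_family S I F \<longleftrightarrow> finite I \<and> disjoint_family_on F I \<and>
     (\<forall>i\<in>I. F i \<subseteq> S \<and> F i \<noteq> {} \<and> card (F i) \<le> DIM('a))"

definition codim_sum :: "'i set \<Rightarrow> ('i \<Rightarrow> 'a::euclidean_space set) \<Rightarrow> nat" where
  "codim_sum I F = (\<Sum>i\<in>I. DIM('a) + 1 - card (F i))"

lemma proper_family_mono:
  "proper_family S I F \<Longrightarrow> J \<subseteq> I \<Longrightarrow> proper_family S J F"
  unfolding proper_family_def using disjoint_family_on_mono[of J I F] finite_subset[of J I] by auto

lemma proper_family_fun_upd:
  fixes F :: "'i \<Rightarrow> 'a::euclidean_space set"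
  assumes "proper_family S I F" "T \<subseteq> S" "T \<noteq> {}" "card T \<le> DIM('a)"
    and "\<And>j. j \<in> I \<Longrightarrow> j \<noteq> i \<Longrightarrow> T \<inter> F j = {}"
  shows "proper_family S I (F(i := T))"
proof -
  have "disjoint_family_on (F(i := T)) I"
    unfolding disjoint_family_on_def
  proof (intro ballI impI)
    fix m n assume "m \<in> I" "n \<in> I" "m \<noteq> n"
    then show "(F(i := T)) m \<inter> (F(i := T)) n = {}"
      using assms(1) assms(5)[of m] assms(5)[of n]
      by (cases "m = i"; cases "n = i") (auto simp: proper_family_def disjoint_family_on_def)
  qed
  then show ?thesis using assms(1-4) by (simp add: proper_family_def)
qed

lemma card_le_codim_sum:
  assumes "proper_family S I F"
  shows "card I \<le> codim_sum I F"
proof -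
  have "(\<Sum>i\<in>I. 1) \<le> codim_sum I F"
    unfolding codim_sum_def using assms by (intro sum_mono) (fastforce simp: proper_family_def)
  then show ?thesis by simp
qed

lemma codim_sum_remove:
  fixes F :: "'i \<Rightarrow> 'a::euclidean_space set"
  assumes "finite I" "i \<in> I"
  shows "codim_sum I F = (DIM('a) + 1 - card (F i)) + codim_sum (I - {i}) F"
  unfolding codim_sum_def using assms by (rule sum.remove)

lemma codim_sum_fun_upd:
  fixes F :: "'i \<Rightarrow> 'a::euclidean_space set"
  assumes "finite I" "i \<in> I"
  shows "codim_sum I (F(i := T)) = (DIM('a) + 1 - card T) + codim_sum (I - {i}) F"
  using codim_sum_remove[OF assms, of "F(i := T)"]
  by (simp add: codim_sum_def)

text \<open>A single nonempty member has \<epsilon> at most d, so a sum above d forces at least two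
  members.\<close>

lemma codim_sum_le_if_card_le_1:
  fixes F :: "'i \<Rightarrow> 'a::euclidean_space set"
  assumes "finite S" "proper_family S I F" "card I \<le> 1"
  shows "codim_sum I F \<le> DIM('a)"
proof (cases "I = {}")
  case True
  then show ?thesis by (simp add: codim_sum_def)
next
  case False
  then have "card I = 1" using assms by (simp add: proper_family_def le_Suc_eq)
  then obtain i where I: "I = {i}" using card_1_singletonE by blast
  then have "card (F i) > 0"
    using assms by (auto simp: proper_family_def card_gt_0_iff intro: finite_subset)
  then show ?thesis by (simp add: I codim_sum_def)
qed

section \<open>From the conditions to strong general position\<close>

text \<open>The right-hand side of the theorem, freed from the index sets \<open>{1..r}\<close> and from the
  bound \<open>r \<le> d + 1\<close>, which follows from the conditions on the sum.\<close>

definition transversality_conditions :: "'a::euclidean_space set \<Rightarrow> bool" where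
  "transversality_conditions S \<longleftrightarrow>
     (\<forall>(I :: nat set) F. proper_family S I F \<and> 2 \<le> card I \<longrightarrow>
        (codim_sum I F = DIM('a) \<longrightarrow> (\<exists>p. (\<Inter>i\<in>I. affine hull (F i)) = {p})) \<and>
        (codim_sum I F = DIM('a) + 1 \<or>
         ((\<Union>i\<in>I. F i) = S \<and> DIM('a) + 1 < codim_sum I F \<and>
          (\<forall>i\<in>I. codim_sum (I - {i}) F \<le> DIM('a))) \<longrightarrow>
         (\<Inter>i\<in>I. affine hull (F i)) = {}))"

text \<open>Strong induction on the sum: discarding or enlarging a member can only enlarge the
  intersection, so emptiness passes back to the given family.\<close>

lemma INT_affine_hull_empty:
  fixes S :: "'a::euclidean_space set" and I :: "nat set"
  assumes "finite S" "transversality_conditions S" "proper_family S I F" "DIM('a) < codim_sum I F"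
  shows "(\<Inter>i\<in>I. affine hull (F i)) = {}"
  using assms(3,4)
proof (induction "codim_sum I F" arbitrary: I F rule: less_induct)
  case less
  have fin: "finite I" and disj: "disjoint_family_on F I"
    using less.prems by (auto simp: proper_family_def)
  have finF: "finite (F i)" if "i \<in> I" for i
    using that less.prems assms(1) by (auto simp: proper_family_def intro: finite_subset)
  have card2: "2 \<le> card I"
    using codim_sum_le_if_card_le_1[OF assms(1) less.prems(1)] less.prems(2) by linarith
  show ?case
  proof (cases "\<exists>i\<in>I. DIM('a) < codim_sum (I - {i}) F")
    case True
    then obtain i where i: "i \<in> I" "DIM('a) < codim_sum (I - {i}) F" by blast
    have "codim_sum (I - {i}) F < codim_sum I F"
      using codim_sum_remove[OF fin i(1), of F] less.prems(1) i(1)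
      by (auto simp: proper_family_def)
    then have "(\<Inter>j\<in>I - {i}. affine hull (F j)) = {}"
      using less.prems(1) i by (intro less.hyps) (auto intro: proper_family_mono)
    then show ?thesis by auto
  next
    case False
    then have le: "\<forall>i\<in>I. codim_sum (I - {i}) F \<le> DIM('a)" by auto
    show ?thesis
    proof (cases "codim_sum I F = DIM('a) + 1 \<or> (\<Union>i\<in>I. F i) = S")
      case True
      then show ?thesis
        using assms(2) less.prems card2 le unfolding transversality_conditions_def
        by (metis Suc_eq_plus1 Suc_leI le_neq_implies_less)
    next
      case False
      have "(\<Union>i\<in>I. F i) \<subseteq> S" using less.prems(1) by (auto simp: proper_family_def)
      then obtain x where x: "x \<in> S" "\<And>i. i \<in> I \<Longrightarrow> x \<notin> F i" using False by blast
      obtain i where i: "i \<in> I" using card2 by fastforce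
      have big: "DIM('a) + 1 < codim_sum I F" using False less.prems(2) by linarith
      \<comment> \<open>The sum is at least d + 2 and at most d without \<open>F i\<close>; hence
        \<open>F i\<close> can absorb \<open>x\<close> and still have at most d points.\<close>
      then have eps: "2 \<le> DIM('a) + 1 - card (F i)"
        using codim_sum_remove[OF fin i, of F] le i by fastforce
      define G where "G = F(i := insert x (F i))"
      have cG: "card (insert x (F i)) = card (F i) + 1"
        using x(2)[OF i] finF[OF i] by simp
      have sum: "codim_sum I G = codim_sum I F - 1"
        unfolding G_def codim_sum_fun_upd[OF fin i] codim_sum_remove[OF fin i, of F]
        using cG eps by simp
      have "proper_family S I G"
        unfolding G_def
      proof (rule proper_family_fun_upd[OF less.prems(1)])
        show "insert x (F i) \<subseteq> S" using less.prems(1) x(1) i by (simp add: proper_family_def)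
        show "card (insert x (F i)) \<le> DIM('a)" using cG eps by simp
        show "insert x (F i) \<inter> F j = {}" if "j \<in> I" "j \<noteq> i" for j
          using disj x(2) i that unfolding disjoint_family_on_def by blast
      qed simp
      then have "(\<Inter>j\<in>I. affine hull (G j)) = {}"
        using sum big by (intro less.hyps) auto
      moreover have "affine hull (F j) \<subseteq> affine hull (G j)" for j
        unfolding G_def by (intro hull_mono) auto
      then have "(\<Inter>j\<in>I. affine hull (F j)) \<subseteq> (\<Inter>j\<in>I. affine hull (G j))"
        by (intro INF_mono')
      ultimately show ?thesis by simp
    qed
  qed
qed

text \<open>Subadditivity bounds the codimension from above. Shrinking one member to a set
  \<open>T\<close> that brings the sum to d leaves a single point, which supplies nonemptiness and
  the bound from below.\<close>

lemma INT_affine_hull_codim: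
  fixes S :: "'a::euclidean_space set" and I :: "nat set"
  assumes "finite S" "general_position S" "transversality_conditions S" "proper_family S I F"
    and "codim_sum I F \<le> DIM('a)"
  shows "int DIM('a) - aff_dim (\<Inter>i\<in>I. affine hull (F i)) = int (codim_sum I F)"
proof -
  have sub: "F i \<subseteq> S" and ne: "F i \<noteq> {}" and le: "card (F i) \<le> DIM('a)"
    if "i \<in> I" for i
    using that assms(4) by (auto simp: proper_family_def)
  have fin: "finite I" using assms(4) by (simp add: proper_family_def)
  have finF: "finite (F i)" if "i \<in> I" for i
    using sub[OF that] assms(1) finite_subset by blast
  have codim: "int DIM('a) - aff_dim (affine hull (F i)) = int (DIM('a) + 1 - card (F i))"
    if "i \<in> I" for i
    using that le[OF that] by (intro general_position_codim[OF assms(2)] sub finF) auto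
  consider "I = {}" | i where "I = {i}" | "2 \<le> card I"
    using fin by (metis One_nat_def card_0_eq card_1_singletonE less_2_cases not_le)
  then show ?thesis
  proof cases
    case 1
    then show ?thesis by (simp add: codim_sum_def)
  next
    case (2 i)
    then show ?thesis using codim[of i] by (simp add: codim_sum_def)
  next
    case 3
    then obtain i where i: "i \<in> I" by fastforce
    \<comment> \<open>A member with \<open>k\<close> points contributes d minus the sum over the
      others, so the new total is exactly d; the summand 1 keeps \<open>T\<close> nonempty.\<close>
    define k where "k = codim_sum (I - {i}) F + 1"
    have kle: "k \<le> card (F i)"
      using assms(5) codim_sum_remove[OF fin i, of F] le[OF i] unfolding k_def by linarith
    then obtain T where T: "T \<subseteq> F i" "card T = k" "finite T"
      using obtain_subset_with_card_n by metis
    define G where "G = F(i := T)"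
    let ?I = "\<Inter>j\<in>I. affine hull (F j)"
    have "proper_family S I G"
      unfolding G_def
    proof (rule proper_family_fun_upd[OF assms(4)])
      show "T \<noteq> {}" using T(2) k_def by auto
      show "card T \<le> DIM('a)" using T(2) kle le[OF i] by simp
      show "T \<inter> F j = {}" if "j \<in> I" "j \<noteq> i" for j
        using assms(4) T(1) i that unfolding proper_family_def disjoint_family_on_def by blast
    qed (use T(1) sub[OF i] in blast)
    moreover have "codim_sum I G = DIM('a)"
      using codim_sum_fun_upd[OF fin i, of F T] T(2) kle le[OF i] unfolding G_def k_def by simp
    ultimately obtain p where p: "(\<Inter>j\<in>I. affine hull (G j)) = {p}"
      using assms(3) 3 unfolding transversality_conditions_def by blast
    have hullT: "affine hull T \<subseteq> affine hull (F i)" using T(1) by (rule hull_mono)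
    have "(\<Inter>j\<in>I. affine hull (G j)) = affine hull T \<inter> ?I"
    proof
      show "(\<Inter>j\<in>I. affine hull (G j)) \<subseteq> affine hull T \<inter> ?I"
      proof
        fix x assume x: "x \<in> (\<Inter>j\<in>I. affine hull (G j))"
        then have "x \<in> affine hull T" using i by (force simp: G_def)
        moreover have "x \<in> affine hull (F j)" if "j \<in> I" for j
          using x that calculation hullT by (cases "j = i") (auto simp: G_def)
        ultimately show "x \<in> affine hull T \<inter> ?I" by blast
      qed
    qed (auto simp: G_def)
    then have Int: "affine hull T \<inter> ?I = {p}" using p by simp
    have aff: "affine ?I" by (intro affine_Inter) auto
    \<comment> \<open>Inside \<open>affine hull (F i)\<close>, the hull of \<open>T\<close> meets
      \<open>?I\<close> in a point, of dimension 0; hence \<open>aff_dim ?I\<close> is at most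
      \<open>card (F i) - k\<close>, which is d minus the sum.\<close>
    have "aff_dim (affine hull T) + aff_dim ?I
        \<le> aff_dim (affine hull (F i)) + aff_dim (affine hull T \<inter> ?I)"
      using hullT aff Int i by (intro aff_dim_Int_ge) auto
    moreover have "int DIM('a) - aff_dim (affine hull T) = int (DIM('a) + 1 - k)"
      using T kle le[OF i] sub[OF i] general_position_codim[OF assms(2), of T] by auto
    moreover have "int DIM('a) - aff_dim ?I \<le> int (codim_sum I F)"
    proof -
      have "int DIM('a) - aff_dim ?I \<le> (\<Sum>j\<in>I. int DIM('a) - aff_dim (affine hull (F j)))"
        using Int by (intro aff_dim_INT_ge fin) auto
      also have "\<dots> = int (codim_sum I F)"
        using codim by (simp add: codim_sum_def)
      finally show ?thesis .
    qed
    ultimately show ?thesis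
      using codim[OF i] codim_sum_remove[OF fin i, of F] kle le[OF i] Int
      unfolding k_def by simp
  qed
qed

lemma strong_general_position_if_transversality_conditions:
  fixes S :: "'a::euclidean_space set"
  assumes "finite S" "general_position S" "transversality_conditions S"
  shows "strong_general_position S"
  unfolding strong_general_position_def
proof (intro conjI assms(1,2) allI impI)
  fix r :: nat and F :: "nat \<Rightarrow> 'a set"
  assume A: "1 \<le> r \<and> r \<le> card S \<and> (\<forall>\<nu>\<in>{1..r}. F \<nu> \<subseteq> S) \<and> disjoint_family_on F {1..r}"
  let ?c = "\<lambda>i. int DIM('a) - aff_dim (affine hull (F i))"
  have c0: "0 \<le> ?c i" for i using aff_dim_le_DIM[of "affine hull (F i)"] by simp
  show "int DIM('a) - aff_dim (\<Inter>\<nu>\<in>{1..r}. affine hull (F \<nu>)) =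
        min (int DIM('a) + 1) (\<Sum>\<nu>=1..r. ?c \<nu>)"
  proof (cases "\<exists>i\<in>{1..r}. F i = {}")
    case True
    then obtain i where i: "i \<in> {1..r}" "F i = {}" by blast
    have "int DIM('a) + 1 = ?c i" using i(2) by simp
    also have "\<dots> \<le> (\<Sum>\<nu>=1..r. ?c \<nu>)" using c0 i(1) by (intro member_le_sum) auto
    moreover have "(\<Inter>\<nu>\<in>{1..r}. affine hull (F \<nu>)) = {}" using i by fastforce
    ultimately show ?thesis by simp
  next
    case False
    define I where "I = {i\<in>{1..r}. card (F i) \<le> DIM('a)}"
    have finF: "finite (F i)" if "i \<in> {1..r}" for i
      using that A assms(1) finite_subset by blast
    have full: "affine hull (F i) = UNIV" if "i \<in> {1..r} - I" for i
      using that A finF by (intro general_position_affine_hull_UNIV[OF assms(2)]) (auto simp: I_def)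
    have INT: "(\<Inter>\<nu>\<in>{1..r}. affine hull (F \<nu>)) = (\<Inter>\<nu>\<in>I. affine hull (F \<nu>))"
      using full unfolding I_def by blast
    have "(\<Sum>\<nu>=1..r. ?c \<nu>) = (\<Sum>\<nu>\<in>I. ?c \<nu>)"
      using full by (intro sum.mono_neutral_right) (auto simp: I_def)
    also have "\<dots> = (\<Sum>\<nu>\<in>I. int (DIM('a) + 1 - card (F \<nu>)))"
      using A finF by (intro sum.cong refl general_position_codim[OF assms(2)]) (auto simp: I_def)
    finally have sum: "(\<Sum>\<nu>=1..r. ?c \<nu>) = int (codim_sum I F)"
      by (simp add: codim_sum_def)
    have fam: "proper_family S I F"
      using A False unfolding proper_family_def I_def disjoint_family_on_def by auto
    show ?thesis
    proof (cases "codim_sum I F \<le> DIM('a)")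
      case True
      then show ?thesis
        using INT_affine_hull_codim[OF assms fam] unfolding INT sum by simp
    next
      case False
      then show ?thesis
        using INT_affine_hull_empty[OF assms(1,3) fam] unfolding INT sum by simp
    qed
  qed
qed

section \<open>The equivalence, stated for families over \<open>{1..r}\<close>\<close>

theorem theorem2p1:
  fixes S :: "'a::euclidean_space set"
  assumes "finite S" and "general_position S" and "card S > DIM('a) + 1"
  shows "strong_general_position S \<longleftrightarrow>
    (\<forall>(r::nat) (F :: nat \<Rightarrow> 'a set) (\<epsilon> :: nat \<Rightarrow> nat).
       2 \<le> r \<and> r \<le> DIM('a) + 1 \<and>
       (\<forall>\<nu>\<in>{1..r}. F \<nu> \<subseteq> S) \<and> disjoint_family_on F {1..r} \<and>
       (\<forall>\<nu>\<in>{1..r}. 1 \<le> \<epsilon> \<nu> \<and> \<epsilon> \<nu> \<le> DIM('a) \<and> card (F \<nu>) = DIM('a) + 1 - \<epsilon> \<nu>) \<longrightarrow>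
       ((\<Sum>\<nu>=1..r. \<epsilon> \<nu>) = DIM('a) \<longrightarrow>
          (\<exists>p. (\<Inter>\<nu>\<in>{1..r}. affine hull (F \<nu>)) = {p})) \<and>
       ((\<Sum>\<nu>=1..r. \<epsilon> \<nu>) = DIM('a) + 1 \<or>
        (card S = r * (DIM('a) + 1) - (\<Sum>\<nu>=1..r. \<epsilon> \<nu>) \<and>
         DIM('a) + 1 < (\<Sum>\<nu>=1..r. \<epsilon> \<nu>) \<and>
         (\<Sum>\<nu>=1..r. \<epsilon> \<nu>) \<le> DIM('a) + Min (\<epsilon> ` {1..r})) \<longrightarrow>
          (\<Inter>\<nu>\<in>{1..r}. affine hull (F \<nu>)) = {}))"
    (is "_ \<longleftrightarrow> ?R")
proof
  assume sgp: "strong_general_position S"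
  show ?R
  proof (intro allI impI, elim conjE)
    fix r :: nat and F :: "nat \<Rightarrow> 'a set" and \<epsilon> :: "nat \<Rightarrow> nat"
    assume r: "2 \<le> r" "r \<le> DIM('a) + 1" and sub: "\<forall>\<nu>\<in>{1..r}. F \<nu> \<subseteq> S"
      and disj: "disjoint_family_on F {1..r}"
      and eps: "\<forall>\<nu>\<in>{1..r}. 1 \<le> \<epsilon> \<nu> \<and> \<epsilon> \<nu> \<le> DIM('a) \<and> card (F \<nu>) = DIM('a) + 1 - \<epsilon> \<nu>"
    let ?X = "\<Inter>\<nu>\<in>{1..r}. affine hull (F \<nu>)"
    have codim: "int DIM('a) - aff_dim (affine hull (F \<nu>)) = int (\<epsilon> \<nu>)" if "\<nu> \<in> {1..r}" for \<nu>
    proof -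
      have "finite (F \<nu>)" using sub[rule_format, OF that] assms(1) by (rule finite_subset)
      then have "int DIM('a) - aff_dim (affine hull (F \<nu>)) = int (DIM('a) + 1 - card (F \<nu>))"
        using that sub eps by (intro general_position_codim[OF assms(2)]) auto
      moreover have "DIM('a) + 1 - card (F \<nu>) = \<epsilon> \<nu>"
        using eps[rule_format, OF that] by linarith
      ultimately show ?thesis by simp
    qed
    \<comment> \<open>The formula is available only for \<open>r \<le> card S\<close>, which holds
      since r \<le> d + 1 < \<open>card S\<close>.\<close>
    have "int DIM('a) - aff_dim ?X
        = min (int DIM('a) + 1) (\<Sum>\<nu>=1..r. int DIM('a) - aff_dim (affine hull (F \<nu>)))"
      using sgp r sub disj assms(3) unfolding strong_general_position_def by auto
    also have "(\<Sum>\<nu>=1..r. int DIM('a) - aff_dim (affine hull (F \<nu>))) = int (\<Sum>\<nu>=1..r. \<epsilon> \<nu>)"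
      using codim by simp
    finally have dim: "int DIM('a) - aff_dim ?X = min (int DIM('a) + 1) (int (\<Sum>\<nu>=1..r. \<epsilon> \<nu>))" .
    have point: "\<exists>p. ?X = {p}" if "(\<Sum>\<nu>=1..r. \<epsilon> \<nu>) = DIM('a)"
    proof -
      have "aff_dim ?X = 0" using dim unfolding that by linarith
      then show ?thesis by (simp only: aff_dim_eq_0)
    qed
    have empty: "?X = {}" if "DIM('a) + 1 \<le> (\<Sum>\<nu>=1..r. \<epsilon> \<nu>)"
    proof -
      have "int DIM('a) + 1 \<le> int (\<Sum>\<nu>=1..r. \<epsilon> \<nu>)" using that by linarith
      then have "aff_dim ?X = -1" using dim by linarith
      then show ?thesis by (simp only: aff_dim_empty)
    qed
    show "((\<Sum>\<nu>=1..r. \<epsilon> \<nu>) = DIM('a) \<longrightarrow> (\<exists>p. ?X = {p})) \<and>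
       ((\<Sum>\<nu>=1..r. \<epsilon> \<nu>) = DIM('a) + 1 \<or>
        (card S = r * (DIM('a) + 1) - (\<Sum>\<nu>=1..r. \<epsilon> \<nu>) \<and>
         DIM('a) + 1 < (\<Sum>\<nu>=1..r. \<epsilon> \<nu>) \<and>
         (\<Sum>\<nu>=1..r. \<epsilon> \<nu>) \<le> DIM('a) + Min (\<epsilon> ` {1..r})) \<longrightarrow> ?X = {})"
      by (intro conjI impI point empty) linarith+
  qed
next
  assume R: ?R
  have "transversality_conditions S"
    unfolding transversality_conditions_def
  proof (intro allI impI, elim conjE)
    fix I :: "nat set" and F :: "nat \<Rightarrow> 'a set"
    assume fam: "proper_family S I F" and card2: "2 \<le> card I"
    let ?X = "\<Inter>i\<in>I. affine hull (F i)"
    have fin: "finite I" using fam by (simp add: proper_family_def)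
    define r where "r = card I"
    \<comment> \<open>\<open>?R\<close> speaks of families over \<open>{1..r}\<close>; the bijection
      \<open>h\<close> transports it to the index set \<open>I\<close>.\<close>
    obtain h where h: "bij_betw h {1..r} I"
      using ex_bij_betw_nat_finite_1[OF fin] unfolding r_def by blast
    then have img: "h ` {1..r} = I" and inj: "inj_on h {1..r}"
      by (auto simp: bij_betw_def)
    define \<epsilon> where "\<epsilon> i = DIM('a) + 1 - card (F i)" for i
    have finF: "finite (F i)" if "i \<in> I" for i
      using that fam assms(1) by (auto simp: proper_family_def intro: finite_subset)
    have cardF: "1 \<le> card (F i)" "card (F i) \<le> DIM('a)" if "i \<in> I" for i
      using that fam finF[OF that] by (auto simp: proper_family_def Suc_le_eq card_gt_0_iff)
    have hI: "h \<nu> \<in> I" if "\<nu> \<in> {1..r}" for \<nu> using that img by blast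
    have sum: "(\<Sum>\<nu>=1..r. \<epsilon> (h \<nu>)) = codim_sum I F"
      using sum.reindex_bij_betw[OF h, of \<epsilon>] by (simp add: codim_sum_def \<epsilon>_def)
    have X: "(\<Inter>\<nu>\<in>{1..r}. affine hull (F (h \<nu>))) = ?X"
      using img by blast
    have H1: "\<forall>\<nu>\<in>{1..r}. F (h \<nu>) \<subseteq> S"
      using fam hI by (auto simp: proper_family_def)
    have H2: "disjoint_family_on (\<lambda>\<nu>. F (h \<nu>)) {1..r}"
      using fam hI inj unfolding proper_family_def disjoint_family_on_def inj_on_def by metis
    have H3: "\<forall>\<nu>\<in>{1..r}. 1 \<le> \<epsilon> (h \<nu>) \<and> \<epsilon> (h \<nu>) \<le> DIM('a) \<and>
        card (F (h \<nu>)) = DIM('a) + 1 - \<epsilon> (h \<nu>)"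
    proof
      fix \<nu> assume "\<nu> \<in> {1..r}"
      with cardF[OF hI] show "1 \<le> \<epsilon> (h \<nu>) \<and> \<epsilon> (h \<nu>) \<le> DIM('a) \<and>
        card (F (h \<nu>)) = DIM('a) + 1 - \<epsilon> (h \<nu>)"
        unfolding \<epsilon>_def by fastforce
    qed
    have main: "(codim_sum I F = DIM('a) \<longrightarrow> (\<exists>p. ?X = {p})) \<and>
       (codim_sum I F = DIM('a) + 1 \<or>
        (card S = r * (DIM('a) + 1) - codim_sum I F \<and>
         DIM('a) + 1 < codim_sum I F \<and>
         codim_sum I F \<le> DIM('a) + Min ((\<lambda>\<nu>. \<epsilon> (h \<nu>)) ` {1..r})) \<longrightarrow> ?X = {})"
      if "r \<le> DIM('a) + 1"
      using R[rule_format, of r "\<lambda>\<nu>. F (h \<nu>)" "\<lambda>\<nu>. \<epsilon> (h \<nu>)"] that card2 H1 H2 H3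
      unfolding sum X r_def[symmetric] by blast
    \<comment> \<open>When the sum is d or d + 1, this yields the bound on \<open>r\<close> that
      \<open>main\<close> requires.\<close>
    have r_le: "r \<le> codim_sum I F" unfolding r_def by (rule card_le_codim_sum[OF fam])
    show "(codim_sum I F = DIM('a) \<longrightarrow> (\<exists>p. ?X = {p})) \<and>
        (codim_sum I F = DIM('a) + 1 \<or>
         ((\<Union>i\<in>I. F i) = S \<and> DIM('a) + 1 < codim_sum I F \<and>
          (\<forall>i\<in>I. codim_sum (I - {i}) F \<le> DIM('a))) \<longrightarrow> ?X = {})"
    proof (intro conjI impI)
      assume "codim_sum I F = DIM('a)"
      then show "\<exists>p. ?X = {p}" using main r_le by auto
    next
      assume "codim_sum I F = DIM('a) + 1 \<or>
         ((\<Union>i\<in>I. F i) = S \<and> DIM('a) + 1 < codim_sum I F \<and>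
          (\<forall>i\<in>I. codim_sum (I - {i}) F \<le> DIM('a)))"
      then show "?X = {}"
      proof
        assume "codim_sum I F = DIM('a) + 1"
        then show ?thesis using main r_le by auto
      next
        assume *: "(\<Union>i\<in>I. F i) = S \<and> DIM('a) + 1 < codim_sum I F \<and>
          (\<forall>i\<in>I. codim_sum (I - {i}) F \<le> DIM('a))"
        obtain i where i: "i \<in> I" using card2 by fastforce
        \<comment> \<open>The other members contribute at least 1 each and at most d together, so
          there are at most d of them.\<close>
        have "card (I - {i}) \<le> DIM('a)"
          using card_le_codim_sum[OF proper_family_mono[OF fam, of "I - {i}"]] * i by fastforce
        then have r: "r \<le> DIM('a) + 1" using i fin unfolding r_def by (simp add: card_Diff_singleton)
        have "card S = (\<Sum>i\<in>I. card (F i))"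
          using card_UN_disjoint'[of F I] fam fin finF * by (simp add: proper_family_def)
        \<comment> \<open>Sizes and codimensions add up to d + 1 member by member, so the truncated
          subtraction in the formula for \<open>card S\<close> is exact.\<close>
        moreover have "(\<Sum>i\<in>I. card (F i)) + codim_sum I F = (\<Sum>i\<in>I. DIM('a) + 1)"
          unfolding codim_sum_def sum.distrib[symmetric] using cardF
          by (intro sum.cong) fastforce+
        ultimately have "card S = r * (DIM('a) + 1) - codim_sum I F"
          by (simp add: r_def)
        moreover have "codim_sum I F \<le> DIM('a) + Min ((\<lambda>\<nu>. \<epsilon> (h \<nu>)) ` {1..r})"
        proof -
          \<comment> \<open>Removing a member \<open>j\<close> that attains the minimum leaves a sum
            of at most d, so the whole sum is at most d plus that minimum.\<close>
          have "Min ((\<lambda>\<nu>. \<epsilon> (h \<nu>)) ` {1..r}) \<in> (\<lambda>\<nu>. \<epsilon> (h \<nu>)) ` {1..r}"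
            using card2 by (intro Min_in) (auto simp: r_def)
          then obtain j where j: "j \<in> I" "Min ((\<lambda>\<nu>. \<epsilon> (h \<nu>)) ` {1..r}) = \<epsilon> j"
            using hI by blast
          show ?thesis
            using * j codim_sum_remove[OF fin j(1), of F] unfolding j(2) \<epsilon>_def by fastforce
        qed
        ultimately show ?thesis using main[OF r] * by blast
      qed
    qed
  qed
  with assms(1,2) show "strong_general_position S"
    by (rule strong_general_position_if_transversality_conditions)
qed

end
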